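(* For every $d>0$ that is realized as the Euclidean distance between two points of $\mathbb{Q}^3$, the complete bipartite graph $K_{2,3}$ is (isomorphic to) a subgraph of $G(\mathbb{Q}^3,d)$.
   Context: For $S \subseteq \mathbb{R}$, a positive integer $n$ and $d>0$, $G(S^n,d)$ denotes the graph with vertex set $S^n$ in which two vertices are adjacent if and only if their Euclidean distance is exactly $d$. Subgraphs need not be induced. *)

theory Defs
  imports "HOL-Analysis.Analysis" "Graph_Theory.Kuratowski"
begin

text \<open>The power \<open>S\<^sup>n\<close> inside Euclidean \<open>n\<close>-space, with \<open>n = CARD('n)\<close>.\<close>

definition cart_power :: "real set \<Rightarrow> (real ^ 'n) set" where
  "cart_power S = {x. \<forall>i. x $ i \<in> S}"

text \<open>
  The graph \<open>G(S\<^sup>n, d)\<close>. As usual in \<open>Graph_Theory\<close>, an undirected graph is a symmetric digraph,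
  so an edge \<open>{x, y}\<close> is the pair of arcs \<open>(x, y)\<close> and \<open>(y, x)\<close>.
\<close>

definition distance_graph :: "real set \<Rightarrow> real \<Rightarrow> (real ^ 'n) pair_pre_digraph" where
  "distance_graph S d =
     \<lparr> pverts = cart_power S,
       parcs = {(x, y). x \<in> cart_power S \<and> y \<in> cart_power S \<and> dist x y = d} \<rparr>"

lemma pair_bidirected_digraph_distance_graph:
  assumes "d > 0"
  shows "pair_bidirected_digraph (distance_graph S d)"
  using assms
  by unfold_locales
    (auto simp: distance_graph_def symmetric_def dist_commute intro!: symI)

end

theory Submission
  imports Defs
begin

text \<open>
  The argument works over any subfield \<open>K\<close> of the reals and in any dimension at least three. Call
  \<open>v = p + q\<close> a splitting of \<open>v\<close> if \<open>p\<close> and \<open>q\<close> are nonzero and orthogonal. Projecting \<open>v\<close> onto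
  \<open>v + r\<close>, where \<open>r\<close> is a nonzero vector orthogonal to \<open>v\<close>, gives a splitting; since Gram-Schmidt
  produces such an \<open>r\<close> without leaving \<open>K\<^sup>n\<close>, every nonzero \<open>v \<in> K\<^sup>n\<close> splits inside \<open>K\<^sup>n\<close>.

  Split \<open>v = p + t\<close>. Every vector orthogonal to \<open>p\<close> of length \<open>|t|\<close> has distance \<open>|v|\<close> from both \<open>p\<close>
  and \<open>-p\<close>. Three such vectors are \<open>t\<close>, \<open>-t\<close> and \<open>a - b\<close>, where \<open>t = a + b\<close> is a splitting
  orthogonal to \<open>p\<close>.
\<close>

lemma ex_complete_bipartite_subgraph_distance_graph:
  fixes U V :: "(real ^ 'n) set"
  assumes "d > 0" and UV: "U \<subseteq> cart_power S" "V \<subseteq> cart_power S"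
    and fin: "finite U" "finite V"
    and dist: "\<And>u v. u \<in> U \<Longrightarrow> v \<in> V \<Longrightarrow> dist u v = d"
  shows "\<exists>H. subgraph H (with_proj (distance_graph S d :: (real ^ 'n) pair_pre_digraph))
           \<and> K\<^bsub>card U,card V\<^esub> H"
proof -
  define H where "H = \<lparr> pverts = U \<union> V, parcs = U \<times> V \<union> V \<times> U \<rparr>"
  have "U \<inter> V = {}"
    using dist \<open>d > 0\<close> by force
  then have bipartite: "K\<^bsub>card U,card V\<^esub> (with_proj H)"
    using fin by (auto simp: complete_bipartite_digraph_pair_def H_def)
  interpret G: pair_bidirected_digraph "distance_graph S d :: (real ^ 'n) pair_pre_digraph"
    using \<open>d > 0\<close> by (rule pair_bidirected_digraph_distance_graph)
  interpret H: pair_graph H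
    using bipartite by (rule pair_graphI_complete_bipartite)
  have "dist v u = d" if "u \<in> U" "v \<in> V" for u v
    using dist[OF that] by (simp add: dist_commute)
  then have "pverts H \<subseteq> pverts (distance_graph S d)" "parcs H \<subseteq> parcs (distance_graph S d)"
    using UV dist by (auto simp: H_def distance_graph_def)
  then have "subgraph (with_proj H) (with_proj (distance_graph S d))"
    using G.wf_digraph H.wf_digraph by (simp add: subgraph_def compatible_def)
  with bipartite show ?thesis
    by blast
qed

lemma dist_eq_norm_add_orthogonal:
  assumes "orthogonal p t" "orthogonal u w" "norm u = norm p" "norm w = norm t"
  shows "dist u w = norm (p + t)"
proof -
  have "(dist u w)\<^sup>2 = (norm (p + t))\<^sup>2"
    using assms norm_add_Pythagorean[of p t] norm_add_Pythagorean[of u "- w"]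
    by (simp add: dist_norm orthogonal_clauses)
  then show ?thesis
    by (simp add: power2_eq_iff_nonneg)
qed

lemma norm_diff_eq_norm_add_orthogonal:
  assumes "orthogonal a b"
  shows "norm (a - b) = norm (a + b)"
  using dist_eq_norm_add_orthogonal[OF assms assms] by (simp add: dist_norm)

lemma orthogonal_projection_splitting:
  fixes v r :: "'a :: real_inner"
  assumes "orthogonal v r" "v \<noteq> 0" "r \<noteq> 0"
  defines "p \<equiv> (v \<bullet> v / ((v + r) \<bullet> (v + r))) *\<^sub>R (v + r)"
  shows "p \<noteq> 0" "v - p \<noteq> 0" "orthogonal p (v - p)"
proof -
  define u where "u = v + r"
  define c where "c = v \<bullet> v / (u \<bullet> u)"
  have p: "p = c *\<^sub>R u"
    by (simp add: p_def c_def u_def)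
  have vr: "v \<bullet> r = 0" "r \<bullet> v = 0"
    using \<open>orthogonal v r\<close> by (simp_all add: orthogonal_def inner_commute)
  then have uv: "u \<bullet> v = v \<bullet> v"
    by (simp add: u_def inner_add_left)
  then have "u \<noteq> 0" "c \<noteq> 0"
    using \<open>v \<noteq> 0\<close> by (auto simp: c_def)
  then show "p \<noteq> 0"
    by (simp add: p)
  have "r \<bullet> (v - p) = - c * (r \<bullet> r)"
    by (simp add: p u_def inner_diff_right inner_add_right vr)
  then show "v - p \<noteq> 0"
    using \<open>r \<noteq> 0\<close> \<open>c \<noteq> 0\<close> by auto
  have "u \<bullet> (v - p) = 0"
    using \<open>u \<noteq> 0\<close> by (simp add: p c_def inner_diff_right uv)
  then show "orthogonal p (v - p)"
    by (simp add: p orthogonal_def)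
qed

lemma ex_axis_notin_span:
  fixes B :: "(real ^ 'n) set"
  assumes "finite B" "card B < CARD('n)"
  obtains i where "axis i 1 \<notin> span B"
proof -
  have "\<not> Basis \<subseteq> span B"
  proof
    assume "Basis \<subseteq> span B"
    then have "span B = UNIV"
      using span_mono[of Basis "span B"] by (simp add: span_span top.extremum_unique)
    then have "CARD('n) = dim B"
      using dim_span[of B] by simp
    with assms dim_le_card'[of B] show False
      by simp
  qed
  with that show thesis
    by (auto simp: Basis_vec_def)
qed

text \<open>Closure under inverses costs no side condition at \<open>0\<close>, as \<open>inverse 0 = 0\<close>.\<close>

locale real_subfield =
  fixes K :: "real set"
  assumes one_closed [simp]: "1 \<in> K"
    and diff_closed [simp]: "x \<in> K \<Longrightarrow> y \<in> K \<Longrightarrow> x - y \<in> K"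
    and mult_closed [simp]: "x \<in> K \<Longrightarrow> y \<in> K \<Longrightarrow> x * y \<in> K"
    and inverse_closed [simp]: "x \<in> K \<Longrightarrow> inverse x \<in> K"
begin

lemma zero_closed [simp]: "0 \<in> K"
  using diff_closed[of 1 1] by simp

lemma uminus_closed [simp]: "x \<in> K \<Longrightarrow> - x \<in> K"
  using diff_closed[of 0 x] by simp

lemma add_closed [simp]: "x \<in> K \<Longrightarrow> y \<in> K \<Longrightarrow> x + y \<in> K"
  using diff_closed[of x "- y"] by simp

lemma divide_closed [simp]: "x \<in> K \<Longrightarrow> y \<in> K \<Longrightarrow> x / y \<in> K"
  by (simp add: divide_inverse)

lemma sum_closed: "(\<And>i. i \<in> I \<Longrightarrow> f i \<in> K) \<Longrightarrow> sum f I \<in> K"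
  by (induction I rule: infinite_finite_induct) auto

lemma cart_power_axis: "c \<in> K \<Longrightarrow> axis i c \<in> cart_power K"
  by (simp add: cart_power_def axis_def)

lemma cart_power_uminus: "x \<in> cart_power K \<Longrightarrow> - x \<in> cart_power K"
  by (simp add: cart_power_def)

lemma cart_power_add: "x \<in> cart_power K \<Longrightarrow> y \<in> cart_power K \<Longrightarrow> x + y \<in> cart_power K"
  by (simp add: cart_power_def)

lemma cart_power_diff: "x \<in> cart_power K \<Longrightarrow> y \<in> cart_power K \<Longrightarrow> x - y \<in> cart_power K"
  by (simp add: cart_power_def)

lemma cart_power_scaleR: "c \<in> K \<Longrightarrow> x \<in> cart_power K \<Longrightarrow> c *\<^sub>R x \<in> cart_power K"
  by (simp add: cart_power_def)

lemma cart_power_sum: "(\<And>i. i \<in> I \<Longrightarrow> f i \<in> cart_power K) \<Longrightarrow> sum f I \<in> cart_power K"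
  by (simp add: cart_power_def sum_closed)

lemma cart_power_inner: "x \<in> cart_power K \<Longrightarrow> y \<in> cart_power K \<Longrightarrow> x \<bullet> y \<in> K"
  by (simp add: cart_power_def inner_vec_def sum_closed)

lemmas cart_power_intros =
  cart_power_axis cart_power_uminus cart_power_add cart_power_diff cart_power_scaleR
  cart_power_sum cart_power_inner

lemma ex_orthogonal_in_cart_power:
  fixes B :: "(real ^ 'n) set"
  assumes B: "B \<subseteq> cart_power K" "pairwise orthogonal B" "card B < CARD('n)"
  obtains r where "r \<in> cart_power K" "r \<noteq> 0" "\<And>b. b \<in> B \<Longrightarrow> orthogonal b r"
proof -
  obtain i where i: "axis i 1 \<notin> span B"
    using B ex_axis_notin_span pairwise_orthogonal_imp_finite by blast
  define e :: "real ^ 'n" where "e = axis i 1"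
  define q where "q = (\<Sum>b\<in>B. (b \<bullet> e / (b \<bullet> b)) *\<^sub>R b)"
  show thesis
  proof
    show "e - q \<in> cart_power K"
      using B unfolding e_def q_def by (auto intro!: cart_power_intros divide_closed)
    have "q \<in> span B"
      unfolding q_def by (intro span_sum span_mul span_base)
    then show "e - q \<noteq> 0"
      using i by (auto simp: e_def)
    show "orthogonal b (e - q)" if "b \<in> B" for b
      unfolding q_def using B that by (intro Gram_Schmidt_step span_base)
  qed
qed

lemma ex_orthogonal_splitting:
  fixes B :: "(real ^ 'n) set"
  assumes v: "v \<in> cart_power K" "v \<noteq> 0" "\<And>b. b \<in> B \<Longrightarrow> orthogonal b v"
    and B: "B \<subseteq> cart_power K" "pairwise orthogonal B" "Suc (card B) < CARD('n)"
  obtains p q where "p \<in> cart_power K" "q \<in> cart_power K" "v = p + q" "p \<noteq> 0" "q \<noteq> 0"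
    "orthogonal p q" "\<And>b. b \<in> B \<Longrightarrow> orthogonal b p" "\<And>b. b \<in> B \<Longrightarrow> orthogonal b q"
proof -
  have "pairwise orthogonal (insert v B)"
    using v B by (auto simp: pairwise_insert orthogonal_commute)
  moreover have "card (insert v B) < CARD('n)"
    using B by (simp add: card_insert_if pairwise_orthogonal_imp_finite)
  ultimately obtain r where r: "r \<in> cart_power K" "r \<noteq> 0"
      and orth_r: "\<And>b. b \<in> insert v B \<Longrightarrow> orthogonal b r"
    using ex_orthogonal_in_cart_power[of "insert v B"] v B by blast
  define c where "c = (v \<bullet> v) / ((v + r) \<bullet> (v + r))"
  define p where "p = c *\<^sub>R (v + r)"
  have "orthogonal v r"
    using orth_r by simp
  note splitting = orthogonal_projection_splitting[OF this \<open>v \<noteq> 0\<close> \<open>r \<noteq> 0\<close>, folded c_def p_def]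
  have "c \<in> K"
    unfolding c_def using v r by (intro divide_closed cart_power_intros)
  then have p: "p \<in> cart_power K"
    unfolding p_def using v r by (intro cart_power_intros)
  have orth_p: "orthogonal b p" if "b \<in> B" for b
    unfolding p_def using v orth_r that by (simp add: orthogonal_clauses)
  show thesis
  proof
    show "p \<in> cart_power K" "v - p \<in> cart_power K" "v = p + (v - p)"
      using v p by (simp_all add: cart_power_diff)
    show "p \<noteq> 0" "v - p \<noteq> 0" "orthogonal p (v - p)"
      by (rule splitting)+
    show "orthogonal b p" "orthogonal b (v - p)" if "b \<in> B" for b
      using v that orth_p by (simp_all add: orthogonal_clauses)
  qed
qed

lemma ex_two_three_equidistant:
  fixes v :: "real ^ 'n"
  assumes "v \<in> cart_power K" "v \<noteq> 0" "CARD('n) \<ge> 3"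
  obtains U V :: "(real ^ 'n) set" where "U \<subseteq> cart_power K" "V \<subseteq> cart_power K"
    "card U = 2" "card V = 3" "\<And>u w. u \<in> U \<Longrightarrow> w \<in> V \<Longrightarrow> dist u w = norm v"
proof -
  obtain p t where p: "p \<in> cart_power K" "p \<noteq> 0" and t: "t \<in> cart_power K" "t \<noteq> 0"
      and v: "v = p + t" and pt: "orthogonal p t"
    by (rule ex_orthogonal_splitting[of v "{}"]) (use assms in simp_all)
  obtain a b where ab: "a \<in> cart_power K" "b \<in> cart_power K" "a \<noteq> 0" "b \<noteq> 0" "orthogonal a b"
      and t_eq: "t = a + b" and p_ab: "orthogonal p a" "orthogonal p b"
    by (rule ex_orthogonal_splitting[of t "{p}"]) (use p t pt assms in simp_all)
  have neq_uminus: "x \<noteq> - x" if "x \<noteq> 0" for x :: "real ^ 'n"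
    using that by (simp add: eq_neg_iff_add_eq_0 flip: scaleR_2)
  have "a - b \<noteq> t" "a - b \<noteq> - t"
    using neq_uminus ab by (auto simp: t_eq algebra_simps)
  have orth: "orthogonal u w" if "u \<in> {p, - p}" "w \<in> {t, - t, a - b}" for u w
    using that pt p_ab by (auto simp: orthogonal_clauses)
  have "norm (a - b) = norm t"
    unfolding t_eq using \<open>orthogonal a b\<close> by (rule norm_diff_eq_norm_add_orthogonal)
  then have norm: "norm w = norm t" if "w \<in> {t, - t, a - b}" for w
    using that by auto
  show thesis
  proof
    show "{p, - p} \<subseteq> cart_power K" "{t, - t, a - b} \<subseteq> cart_power K"
      using p t ab by (auto intro: cart_power_intros)
    show "card {p, - p} = 2" "card {t, - t, a - b} = 3"
      using neq_uminus p t \<open>a - b \<noteq> t\<close> \<open>a - b \<noteq> - t\<close> by auto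
    show "dist u w = norm v" if "u \<in> {p, - p}" "w \<in> {t, - t, a - b}" for u w
      unfolding v using pt orth[OF that] _ norm[OF that(2)]
      by (rule dist_eq_norm_add_orthogonal) (use that in auto)
  qed
qed

theorem K23_subgraph_distance_graph:
  fixes x y :: "real ^ 'n"
  assumes "x \<in> cart_power K" "y \<in> cart_power K" "x \<noteq> y" "CARD('n) \<ge> 3"
  shows "\<exists>H. subgraph H (with_proj (distance_graph K (dist x y) :: (real ^ 'n) pair_pre_digraph))
           \<and> K\<^bsub>2,3\<^esub> H"
proof -
  have "x - y \<in> cart_power K" "x - y \<noteq> 0"
    using assms by (auto intro: cart_power_diff)
  then obtain U V :: "(real ^ 'n) set" where UV: "U \<subseteq> cart_power K" "V \<subseteq> cart_power K"
      and card: "card U = 2" "card V = 3"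
      and dist: "\<And>u w. u \<in> U \<Longrightarrow> w \<in> V \<Longrightarrow> dist u w = dist x y"
    using ex_two_three_equidistant assms unfolding dist_norm by metis
  have "finite U" "finite V"
    using card by (auto intro: card_ge_0_finite)
  then show ?thesis
    using ex_complete_bipartite_subgraph_distance_graph[of "dist x y" U K V] UV card dist assms
    by simp
qed

end

interpretation Rats: real_subfield \<rat>
  by unfold_locales auto

theorem theorem3p3:
  fixes d :: real
  assumes "d > 0"
    and "\<exists>x \<in> (cart_power \<rat> :: (real ^ 3) set). \<exists>y \<in> cart_power \<rat>. dist x y = d"
  shows "\<exists>H. subgraph H (with_proj (distance_graph \<rat> d :: (real ^ 3) pair_pre_digraph))
           \<and> K\<^bsub>2,3\<^esub> H"
proof -
  obtain x y :: "real ^ 3" where "x \<in> cart_power \<rat>" "y \<in> cart_power \<rat>" and d: "d = dist x y"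
    using assms(2) by blast
  moreover have "x \<noteq> y"
    using d \<open>d > 0\<close> by auto
  ultimately show ?thesis
    unfolding d by (intro Rats.K23_subgraph_distance_graph) simp_all
qed

end
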